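(* Let $(A,B)$ and $(C,D)$ be bounded intervals, let $\gamma_1,\gamma_2,\gamma_3,\gamma_4,\varkappa,\varrho,\Upsilon\in\mathbb{C}$ have positive real parts and let $\nu_1,\nu_2\in\mathbb{C}$. The double integral operator ${}_{A^+,C^+}\mathbb{I}_{\varkappa,\varrho,\Upsilon,\nu_1,\nu_2}^{\gamma_1;\gamma_2;\gamma_3;\gamma_4}$ is bounded on the space $L_1((A,B)\times(C,D))$: there is a constant $K$, independent of $\psi$, such that for all $\psi\in L_1((A,B)\times(C,D))$ $$\left\|{}_{A^+,C^+}\mathbb{I}_{\varkappa,\varrho,\Upsilon,\nu_1,\nu_2}^{\gamma_1;\gamma_2;\gamma_3;\gamma_4}\psi\right\|_1\le K\|\psi\|_1.$$
   Context: $(a)_k$ is the Pochhammer symbol. The modified bivariate H–K Mittag-Leffler function is $$E_{\varkappa,\varrho,\Upsilon}^{(\gamma_1;\gamma_2;\gamma_3;\gamma_4)}(X,Y)=\sum_{s=0}^\infty\sum_{r=0}^\infty\frac{(\gamma_1)_{2s}(\gamma_2)_{s+r}X^sY^{\Upsilon r}}{(\gamma_3)_s(\gamma_4)_s\Gamma(\varkappa+s)\Gamma(\varrho+\Upsilon r)\,r!\,s!}.$$ The operator is, for $X>A$, $Y>C$, $$\left({}_{A^+,C^+}\mathbb{I}_{\varkappa,\varrho,\Upsilon,\nu_1,\nu_2}^{\gamma_1;\gamma_2;\gamma_3;\gamma_4}\psi\right)(X,Y)=\int_C^Y\int_A^X(X-t)^{\varkappa-1}(Y-\Omega)^{\varrho-1}E_{\varkappa,\varrho,\Upsilon}^{(\gamma_1;\gamma_2;\gamma_3;\gamma_4)}(\nu_1(X-t),\nu_2(Y-\Omega))\psi(t,\Omega)\,dt\,d\Omega,$$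 with $(\nu_2(Y-\Omega))^{\Upsilon r}=(\nu_2^\Upsilon)^r(Y-\Omega)^{\Upsilon r}$ for a fixed value of $\nu_2^\Upsilon$. $\|f\|_1=\int_A^B\int_C^D|f(X,Y)|\,dY\,dX$ and $L_1$ is the space of $f$ with $\|f\|_1<\infty$. *)

theory Defs
  imports "HOL-Analysis.Analysis"
begin

text \<open>
  The complex power \<open>z\<^sup>a\<close> is multivalued. These are all its values, with \<open>0\<^sup>a = 0\<close>,
  which is the usual convention for \<open>Re a > 0\<close>.
\<close>

definition cpow_values :: "complex \<Rightarrow> complex \<Rightarrow> complex set" where
  "cpow_values z a = (if z = 0 then {0} else {exp (a * l) | l. exp l = z})"

text \<open>
  The bivariate function at \<open>(X, Y)\<close>. Since \<open>Y\<close> enters only through the powers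
  \<open>Y\<close> to the \<open>\<Upsilon> r\<close>, whose values depend on a choice of branch, the argument \<open>P\<close> supplies
  these values: \<open>P r\<close> stands for the chosen value of \<open>Y\<close> to the \<open>\<Upsilon> r\<close>.
\<close>

definition HK_ML ::
  "complex \<Rightarrow> complex \<Rightarrow> complex \<Rightarrow> complex \<Rightarrow> complex \<Rightarrow> complex \<Rightarrow> complex
    \<Rightarrow> complex \<Rightarrow> (nat \<Rightarrow> complex) \<Rightarrow> complex" where
  "HK_ML \<kappa> \<rho> \<Upsilon> \<gamma>1 \<gamma>2 \<gamma>3 \<gamma>4 X P =
    (\<Sum>s. \<Sum>r. pochhammer \<gamma>1 (2 * s) * pochhammer \<gamma>2 (s + r) * X ^ s * P r /
      (pochhammer \<gamma>3 s * pochhammer \<gamma>4 s * Gamma (\<kappa> + of_nat s) * Gamma (\<rho> + \<Upsilon> * of_nat r)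
        * fact r * fact s))"

text \<open>
  The kernel of the operator, for \<open>t < X\<close> and \<open>\<Omega> < Y\<close>. The parameter \<open>\<omega>\<close> is the fixed value
  of \<open>\<nu>\<^sub>2\<close> to the \<open>\<Upsilon>\<close>, and powers with a positive real base are the principal ones.
  For \<open>r = 0\<close> the factor \<open>\<omega> ^ r\<close> is \<open>1\<close> even if \<open>\<omega> = 0\<close>.
\<close>

definition HK_kernel ::
  "complex \<Rightarrow> complex \<Rightarrow> complex \<Rightarrow> complex \<Rightarrow> complex \<Rightarrow> complex \<Rightarrow> complex \<Rightarrow> complex \<Rightarrow> complex
    \<Rightarrow> real \<times> real \<Rightarrow> real \<times> real \<Rightarrow> complex" where
  "HK_kernel \<kappa> \<rho> \<Upsilon> \<nu>1 \<omega> \<gamma>1 \<gamma>2 \<gamma>3 \<gamma>4 = (\<lambda>(X, Y) (t, \<Omega>).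
    of_real (X - t) powr (\<kappa> - 1) * of_real (Y - \<Omega>) powr (\<rho> - 1) *
    HK_ML \<kappa> \<rho> \<Upsilon> \<gamma>1 \<gamma>2 \<gamma>3 \<gamma>4 (\<nu>1 * of_real (X - t))
      (\<lambda>r. \<omega> ^ r * of_real (Y - \<Omega>) powr (\<Upsilon> * of_nat r)))"

definition HK_op ::
  "real \<Rightarrow> real \<Rightarrow> complex \<Rightarrow> complex \<Rightarrow> complex \<Rightarrow> complex \<Rightarrow> complex \<Rightarrow> complex \<Rightarrow> complex
    \<Rightarrow> complex \<Rightarrow> complex \<Rightarrow> (real \<times> real \<Rightarrow> complex) \<Rightarrow> real \<times> real \<Rightarrow> complex" where
  "HK_op A C \<kappa> \<rho> \<Upsilon> \<nu>1 \<omega> \<gamma>1 \<gamma>2 \<gamma>3 \<gamma>4 \<psi> = (\<lambda>(X, Y).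
    LINT \<Omega>:{C<..<Y}|lebesgue. (LINT t:{A<..<X}|lebesgue.
      HK_kernel \<kappa> \<rho> \<Upsilon> \<nu>1 \<omega> \<gamma>1 \<gamma>2 \<gamma>3 \<gamma>4 (X, Y) (t, \<Omega>) * \<psi> (t, \<Omega>)))"

definition L1_norm ::
  "real \<Rightarrow> real \<Rightarrow> real \<Rightarrow> real \<Rightarrow> (real \<times> real \<Rightarrow> complex) \<Rightarrow> ennreal" where
  "L1_norm A B C D f =
    (\<integral>\<^sup>+X\<in>{A<..<B}. (\<integral>\<^sup>+Y\<in>{C<..<D}. ennreal (norm (f (X, Y))) \<partial>lebesgue) \<partial>lebesgue)"

text \<open>
  Functions rather than classes modulo null sets; values outside the rectangle are irrelevant.
\<close>

definition L1_space ::
  "real \<Rightarrow> real \<Rightarrow> real \<Rightarrow> real \<Rightarrow> (real \<times> real \<Rightarrow> complex) set" where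
  "L1_space A B C D =
    {f. f \<in> borel_measurable (lebesgue_on ({A<..<B} \<times> {C<..<D})) \<and> L1_norm A B C D f < \<infinity>}"

end

theory Submission
  imports Defs
begin

text \<open>
  The terms of the double series are at most a constant times
  \<open>a\<^sup>s / s! \<cdot> b\<^sup>r / |\<Gamma>(\<rho> + \<Upsilon> r)|\<close>: the four Pochhammer symbols, \<open>\<Gamma>(\<kappa> + s)\<close> and the
  factorials leave one factor \<open>s!\<close> in the denominator. Along the ray \<open>\<rho> + \<Upsilon> r\<close> the modulus of
  \<open>\<Gamma>\<close> is, up to an exponential factor, its value at the real part, which grows faster than any
  exponential. So the bivariate function is bounded on the rectangle and the kernel is dominated by
  \<open>M (X - t)\<close> to the \<open>Re \<kappa> - 1\<close> times \<open>(Y - \<Omega>)\<close> to the \<open>Re \<rho> - 1\<close>, whose integral over \<open>(X, Y)\<close> is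
  bounded uniformly in \<open>(t, \<Omega>)\<close>. Tonelli's theorem then gives the estimate, after \<open>\<psi>\<close> has been
  replaced by a Borel function equal to it almost everywhere.
\<close>

subsection \<open>Lebesgue measure on the plane\<close>

text \<open>The kernel has to be measurable on all pairs of points, so bases of every sign occur. On
  the real axis the principal logarithm is \<open>ln x\<close> or \<open>ln (- x) + i pi\<close>,
  which makes the power a piecewise Borel expression.\<close>

lemma measurable_of_real_powr [measurable]:
  assumes [measurable]: "f \<in> borel_measurable M"
  shows "(\<lambda>x. complex_of_real (f x) powr a) \<in> borel_measurable M"
proof -
  have "complex_of_real x powr a =
    (if x > 0 then exp (a * of_real (ln x)) else if x = 0 then 0
     else exp (a * (of_real (ln (- x)) + \<i> * pi)))" for x :: real
    by (simp add: powr_def Ln_of_real Ln_of_real' mult.commute)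
  then show ?thesis by simp
qed

text \<open>Tonelli's theorem asks for measurability in the product sigma-algebra, while Lebesgue
  measure on the plane lives on its completion. The real and imaginary parts of the extension by
  zero are replaced separately.\<close>

lemma borel_version_complex:
  fixes f :: "'a :: euclidean_space \<Rightarrow> complex"
  assumes f: "f \<in> borel_measurable (lebesgue_on R)" and R: "R \<in> sets borel"
  obtains g where "g \<in> borel_measurable borel" "AE q in lborel. q \<in> R \<longrightarrow> f q = g q"
proof -
  have 1: "(\<lambda>q. indicator R q *\<^sub>R f q) \<in> borel_measurable lebesgue"
    using f R by (subst (asm) borel_measurable_restrict_space_iff) auto
  have "(\<lambda>q. Re (indicator R q *\<^sub>R f q)) \<in> borel_measurable lebesgue"
    "(\<lambda>q. Im (indicator R q *\<^sub>R f q)) \<in> borel_measurable lebesgue"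
    using measurable_compose[OF 1 borel_measurable_Re] measurable_compose[OF 1 borel_measurable_Im]
    by auto
  from this[THEN completion_ex_borel_measurable_real]
  obtain u v where uv: "u \<in> borel_measurable borel" "v \<in> borel_measurable borel"
    "AE q in lborel. Re (indicator R q *\<^sub>R f q) = u q" "AE q in lborel. Im (indicator R q *\<^sub>R f q) = v q"
    by auto
  have "(\<lambda>q. Complex (u q) (v q)) \<in> borel_measurable borel"
    using uv(1,2) unfolding Complex_eq by measurable
  moreover have "AE q in lborel. q \<in> R \<longrightarrow> f q = Complex (u q) (v q)"
    using uv(3,4) by eventually_elim (auto simp: complex_eq_iff)
  ultimately show ?thesis by (rule that)
qed

lemma AE_lborel_pairD:
  fixes P :: "'a :: euclidean_space \<times> 'b :: euclidean_space \<Rightarrow> bool"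
  assumes "AE q in lborel. P q"
  shows "AE x in lborel. AE y in lborel. P (x, y)" "AE y in lborel. AE x in lborel. P (x, y)"
proof -
  have 1: "AE q in lborel \<Otimes>\<^sub>M lborel. P q" using assms unfolding lborel_prod .
  show "AE x in lborel. AE y in lborel. P (x, y)"
    using lborel_pair.AE_pair[OF 1] .
  \<comment> \<open>The exceptional set of \<open>P\<close> may be non-measurable, and exchanging
    the two quantifiers needs a measurable one; a null set \<open>N\<close> containing it takes its
    place.\<close>
  obtain N where N: "N \<in> sets (lborel \<Otimes>\<^sub>M lborel)" "emeasure (lborel \<Otimes>\<^sub>M lborel) N = 0"
      "{q \<in> space (lborel \<Otimes>\<^sub>M lborel). \<not> P q} \<subseteq> N"
    using 1 by (rule AE_E) auto
  have "AE q in lborel \<Otimes>\<^sub>M lborel. q \<notin> N"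
    using N by (intro AE_not_in) auto
  moreover have "{q \<in> space (lborel \<Otimes>\<^sub>M lborel). (fst q, snd q) \<notin> N}
      \<in> sets (lborel \<Otimes>\<^sub>M lborel)"
    using sets.compl_sets[OF N(1)] by (auto simp: set_diff_eq)
  ultimately have "AE y in lborel. AE x in lborel. (x, y) \<notin> N"
    by (subst lborel_pair.AE_commute[symmetric]) (auto dest: lborel_pair.AE_pair)
  then show "AE y in lborel. AE x in lborel. P (x, y)"
    using N(3) by (auto simp: space_pair_measure elim!: eventually_mono)
qed

text \<open>Preimages under \<open>f\<close> and \<open>g\<close> differ by a subset of a null set,
  and the completion contains all such subsets.\<close>

lemma measurable_completion_AE_cong:
  assumes g: "g \<in> measurable M N" and ae: "AE x in M. f x = g x"
    and f: "\<And>x. x \<in> space M \<Longrightarrow> f x \<in> space N"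
  shows "f \<in> measurable (completion M) N"
proof (rule measurableI)
  fix S assume S: "S \<in> sets N"
  show "f -` S \<inter> space (completion M) \<in> sets (completion M)"
  proof (rule completion.in_sets_AE)
    show "g -` S \<inter> space (completion M) \<in> sets (completion M)"
      using measurable_completion[OF g] S by (rule measurable_sets)
    show "AE x in completion M. (x \<in> g -` S \<inter> space (completion M)) = (x \<in> f -` S \<inter> space (completion M))"
      using AE_completion[OF ae] by eventually_elim auto
  qed auto
qed (use f in auto)

text \<open>Measurability of \<open>f\<close> is derived from that of \<open>g\<close>, so
  \<open>f\<close> may be an inner Lebesgue integral viewed as a function of the outer
  variable.\<close>

lemma integral_completion_AE_cong:
  fixes f g :: "'a \<Rightarrow> 'b :: {banach, second_countable_topology}"
  assumes g: "g \<in> borel_measurable M" and ae: "AE x in M. f x = g x"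
  shows "integral\<^sup>L (completion M) f = integral\<^sup>L M g"
    and "integrable (completion M) f \<longleftrightarrow> integrable M g"
proof -
  have f: "f \<in> borel_measurable (completion M)"
    by (rule measurable_completion_AE_cong[OF g ae]) auto
  have "integral\<^sup>L (completion M) f = integral\<^sup>L (completion M) g"
    by (rule integral_cong_AE[OF f measurable_completion[OF g] AE_completion[OF ae]])
  then show "integral\<^sup>L (completion M) f = integral\<^sup>L M g"
    by (simp add: integral_completion[OF g])
  have "integrable (completion M) f \<longleftrightarrow> integrable (completion M) g"
    by (rule integrable_cong_AE[OF f measurable_completion[OF g] AE_completion[OF ae]])
  then show "integrable (completion M) f \<longleftrightarrow> integrable M g"
    by (simp add: integrable_completion[OF g])
qed

text \<open>In the non-integrable case the left side is 0 by convention. The bound can thus be used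
  inside nested integrals before their integrability is known.\<close>

lemma norm_integral_le_nn_integral:
  fixes f :: "'a \<Rightarrow> 'b :: {banach, second_countable_topology}"
  shows "ennreal (norm (integral\<^sup>L M f)) \<le> (\<integral>\<^sup>+x. ennreal (norm (f x)) \<partial>M)"
  by (cases "integrable M f") (auto intro: integral_norm_bound_ennreal simp: not_integrable_integral_eq)

lemma L1_norm_lborel:
  assumes [measurable]: "g \<in> borel_measurable borel"
    and ae: "AE q in lborel. q \<in> {A<..<B} \<times> {C<..<D} \<longrightarrow> f q = g q"
  shows "L1_norm A B C D f =
    (\<integral>\<^sup>+q. ennreal (norm (g q)) * indicator ({A<..<B} \<times> {C<..<D}) q \<partial>lborel)"
proof -
  have [measurable]: "g \<in> borel_measurable (lborel \<Otimes>\<^sub>M lborel)"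
    by (simp add: lborel_prod)
  have "L1_norm A B C D f =
      (\<integral>\<^sup>+X. (\<integral>\<^sup>+Y. ennreal (norm (f (X, Y))) * indicator {C<..<D} Y \<partial>lborel) * indicator {A<..<B} X \<partial>lborel)"
    by (simp add: L1_norm_def nn_integral_completion)
  also have "\<dots> = (\<integral>\<^sup>+X. (\<integral>\<^sup>+Y. ennreal (norm (g (X, Y))) * indicator ({A<..<B} \<times> {C<..<D}) (X, Y) \<partial>lborel) \<partial>lborel)"
  proof (rule nn_integral_cong_AE)
    show "AE X in lborel. (\<integral>\<^sup>+Y. ennreal (norm (f (X, Y))) * indicator {C<..<D} Y \<partial>lborel) * indicator {A<..<B} X
      = (\<integral>\<^sup>+Y. ennreal (norm (g (X, Y))) * indicator ({A<..<B} \<times> {C<..<D}) (X, Y) \<partial>lborel)"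
      using AE_lborel_pairD(1)[OF ae]
    proof eventually_elim
      case (elim X)
      then show ?case
        by (auto simp: indicator_def intro!: nn_integral_cong_AE)
    qed
  qed
  also have "\<dots> = (\<integral>\<^sup>+q. ennreal (norm (g q)) * indicator ({A<..<B} \<times> {C<..<D}) q \<partial>(lborel \<Otimes>\<^sub>M lborel))"
    by (subst lborel.nn_integral_fst) auto
  finally show ?thesis by (simp add: lborel_prod)
qed

subsection \<open>Triangular integral operators on \<open>L\<^sub>1\<close>\<close>

lemma L1_bounded_triangular_kernel:
  fixes k :: "real \<times> real \<Rightarrow> real \<times> real \<Rightarrow> complex" and K :: real and A B C D :: real
  defines "R \<equiv> {A<..<B} \<times> {C<..<D}"
    and "T \<equiv> (\<lambda>\<psi> (X, Y). LINT \<Omega>:{C<..<Y}|lebesgue.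
      (LINT t:{A<..<X}|lebesgue. k (X, Y) (t, \<Omega>) * \<psi> (t, \<Omega>)))"
  assumes k: "(\<lambda>(p, q). k p q) \<in> borel_measurable (borel \<Otimes>\<^sub>M borel)"
    and bound: "\<And>t \<Omega>. t \<in> {A<..<B} \<Longrightarrow> \<Omega> \<in> {C<..<D} \<Longrightarrow>
      (\<integral>\<^sup>+p. ennreal (norm (k p (t, \<Omega>))) * indicator ({t<..<B} \<times> {\<Omega><..<D}) p \<partial>lborel) \<le> ennreal K"
    and \<psi>: "\<psi> \<in> L1_space A B C D"
  shows "AE (X, Y) in lebesgue_on R.
      (\<lambda>q. k (X, Y) q * \<psi> q) absolutely_integrable_on ({A<..<X} \<times> {C<..<Y})"
    and "T \<psi> \<in> L1_space A B C D"
    and "L1_norm A B C D (T \<psi>) \<le> ennreal K * L1_norm A B C D \<psi>"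
proof -
  have box [measurable]: "{a<..<b} \<times> {c<..<d} \<in> sets borel" for a b c d :: real
    by (auto simp: borel_prod[symmetric])
  then have R [measurable]: "R \<in> sets borel"
    by (simp add: R_def)
  from \<psi> have \<psi>1: "\<psi> \<in> borel_measurable (lebesgue_on R)" and \<psi>2: "L1_norm A B C D \<psi> < \<infinity>"
    by (auto simp: L1_space_def R_def)
  obtain g where g [measurable]: "g \<in> borel_measurable borel"
    and ae: "AE q in lborel. q \<in> R \<longrightarrow> \<psi> q = g q"
    by (rule borel_version_complex[OF \<psi>1 R])
  have fst_snd [measurable (raw)]: "(\<lambda>x. fst (h x)) \<in> borel_measurable M"
      "(\<lambda>x. snd (h x)) \<in> borel_measurable M"
    if "h \<in> borel_measurable M" for h :: "'z \<Rightarrow> real \<times> real" and M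
    using that measurable_fst'[of h M borel borel] measurable_snd'[of h M borel borel]
    by (simp_all add: borel_prod)
  have k2 [measurable (raw)]: "(\<lambda>x. k (u x) (v x)) \<in> borel_measurable M"
    if "u \<in> borel_measurable M" "v \<in> borel_measurable M" for u v and M :: "'z measure"
    using measurable_compose[OF measurable_Pair[OF that] k] by simp
  define S where "S = (\<lambda>(X, Y). LINT \<Omega>|lborel. indicator {C<..<Y} \<Omega> *\<^sub>R
      (LINT t|lborel. indicator {A<..<X} t *\<^sub>R (k (X, Y) (t, \<Omega>) * g (t, \<Omega>))))"
  have S [measurable]: "S \<in> borel_measurable borel"
  proof -
    \<comment> \<open>With inequalities in place of indicators of intervals depending on
      \<open>p\<close>, joint measurability in \<open>p\<close> and the integration variables can be
      read off.\<close>
    have "S = (\<lambda>p. LINT \<Omega>|lborel. (if C < \<Omega> \<and> \<Omega> < snd p then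
      (LINT t|lborel. (if A < t \<and> t < fst p then k (fst p, snd p) (t, \<Omega>) * g (t, \<Omega>) else 0)) else 0))"
      by (auto simp: S_def fun_eq_iff indicator_def intro!: Bochner_Integration.integral_cong)
    also have "\<dots> \<in> borel_measurable (borel \<Otimes>\<^sub>M borel)"
      by measurable
    finally show ?thesis by (simp add: borel_prod)
  qed
  \<comment> \<open>Equality holds at every point of \<open>R\<close>: the null set where \<psi> and
    \<open>g\<close> differ does not depend on \<open>p\<close>, and almost all its slices at fixed
    \<Omega> are null, so the nested integrals do not see it.\<close>
  have TS: "T \<psi> p = S p" if "p \<in> R" for p
  proof -
    obtain X Y where p: "p = (X, Y)" by force
    have "(LINT \<Omega>|lebesgue. indicator {C<..<Y} \<Omega> *\<^sub>R
        (LINT t|lebesgue. indicator {A<..<X} t *\<^sub>R (k (X, Y) (t, \<Omega>) * \<psi> (t, \<Omega>)))) =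
      (LINT \<Omega>|lborel. indicator {C<..<Y} \<Omega> *\<^sub>R
        (LINT t|lborel. indicator {A<..<X} t *\<^sub>R (k (X, Y) (t, \<Omega>) * g (t, \<Omega>))))"
    proof (rule integral_completion_AE_cong(1))
      show "AE \<Omega> in lborel. indicator {C<..<Y} \<Omega> *\<^sub>R
          (LINT t|lebesgue. indicator {A<..<X} t *\<^sub>R (k (X, Y) (t, \<Omega>) * \<psi> (t, \<Omega>))) =
        indicator {C<..<Y} \<Omega> *\<^sub>R
          (LINT t|lborel. indicator {A<..<X} t *\<^sub>R (k (X, Y) (t, \<Omega>) * g (t, \<Omega>)))"
        using AE_lborel_pairD(2)[OF ae]
      proof eventually_elim
        case (elim \<Omega>)
        have "(LINT t|lebesgue. indicator {A<..<X} t *\<^sub>R (k (X, Y) (t, \<Omega>) * \<psi> (t, \<Omega>))) =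
          (LINT t|lborel. indicator {A<..<X} t *\<^sub>R (k (X, Y) (t, \<Omega>) * g (t, \<Omega>)))"
          if "\<Omega> \<in> {C<..<Y}"
        proof (rule integral_completion_AE_cong(1))
          show "AE t in lborel. indicator {A<..<X} t *\<^sub>R (k (X, Y) (t, \<Omega>) * \<psi> (t, \<Omega>)) =
              indicator {A<..<X} t *\<^sub>R (k (X, Y) (t, \<Omega>) * g (t, \<Omega>))"
            using elim
            by eventually_elim (use \<open>p \<in> R\<close> that in \<open>auto simp: p R_def indicator_def\<close>)
        qed measurable
        then show ?case by (auto simp: indicator_def)
      qed
    qed measurable
    then show ?thesis by (simp add: T_def S_def p set_lebesgue_integral_def)
  qed
  define I where "I = (\<lambda>p q. indicator R p *
      indicator ({A<..<fst p} \<times> {C<..<snd p}) q * ennreal (norm (k p q * g q)))"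
  \<comment> \<open>The triangle read from the other side: A < t < X < B says both that t lies in
    (A, B) and that X lies in (t, B), and likewise for the second coordinates.\<close>
  have I_eq: "I p q = indicator R q * (ennreal (norm (g q)) *
      (ennreal (norm (k p q)) * indicator ({fst q<..<B} \<times> {snd q<..<D}) p))" for p q
    by (auto simp: I_def R_def indicator_def norm_mult ennreal_mult mult.commute)
  have I [measurable]: "(\<lambda>(p, q). I p q) \<in> borel_measurable (borel \<Otimes>\<^sub>M borel)"
  proof -
    have "(\<lambda>(p, q). I p q) = (\<lambda>(p, q). if p \<in> R \<and> A < fst q \<and> fst q < fst p \<and> C < snd q \<and> snd q < snd p
      then ennreal (norm (k p q * g q)) else 0)"
      by (auto simp: I_def fun_eq_iff indicator_def)
    also have "\<dots> \<in> borel_measurable (borel \<Otimes>\<^sub>M borel)"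
      by measurable
    finally show ?thesis .
  qed
  have I' [measurable]: "(\<lambda>(p, q). I p q) \<in> borel_measurable (lborel \<Otimes>\<^sub>M lborel)"
    by (subst measurable_cong_sets[OF sets_pair_measure_cong refl]) auto
  have Ip [measurable]: "I p \<in> borel_measurable borel" for p
    using measurable_compose[OF measurable_Pair1'[of p borel borel] I] by simp
  have S_le: "ennreal (norm (S p)) * indicator R p \<le> (\<integral>\<^sup>+q. I p q \<partial>lborel)" for p
  proof -
    obtain X Y where p: "p = (X, Y)" by force
    have "ennreal (norm (S p)) * indicator R p \<le>
      indicator R p * (\<integral>\<^sup>+\<Omega>. ennreal (norm (indicator {C<..<Y} \<Omega> *\<^sub>R
      (LINT t|lborel. indicator {A<..<X} t *\<^sub>R (k (X, Y) (t, \<Omega>) * g (t, \<Omega>))))) \<partial>lborel)"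
      unfolding p S_def prod.case
      by (subst mult.commute) (intro mult_left_mono norm_integral_le_nn_integral, auto)
    also have "\<dots> \<le> indicator R p * (\<integral>\<^sup>+\<Omega>. indicator {C<..<Y} \<Omega> *
      (\<integral>\<^sup>+t. ennreal (norm (indicator {A<..<X} t *\<^sub>R (k (X, Y) (t, \<Omega>) * g (t, \<Omega>)))) \<partial>lborel) \<partial>lborel)"
      by (intro mult_left_mono nn_integral_mono)
        (simp_all add: norm_integral_le_nn_integral del: norm_scaleR split: split_indicator)
    also have "\<dots> = (\<integral>\<^sup>+\<Omega>. (\<integral>\<^sup>+t. I p (t, \<Omega>) \<partial>lborel) \<partial>lborel)"
      by (auto simp: I_def p indicator_def intro!: nn_integral_cong)
    also have "\<dots> = (\<integral>\<^sup>+q. I p q \<partial>lborel)"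
      by (subst lborel_pair.nn_integral_snd) (auto simp: lborel_prod)
    finally show ?thesis .
  qed
  have tonelli: "(\<integral>\<^sup>+p. (\<integral>\<^sup>+q. I p q \<partial>lborel) \<partial>lborel) \<le> ennreal K * L1_norm A B C D \<psi>"
  proof -
    have "(\<integral>\<^sup>+p. (\<integral>\<^sup>+q. I p q \<partial>lborel) \<partial>lborel) = (\<integral>\<^sup>+q. (\<integral>\<^sup>+p. I p q \<partial>lborel) \<partial>lborel)"
      by (rule lborel_pair.Fubini'[symmetric, OF I'])
    also have "\<dots> \<le> (\<integral>\<^sup>+q. ennreal K * (ennreal (norm (g q)) * indicator R q) \<partial>lborel)"
    proof (rule nn_integral_mono)
      fix q
      have "(\<integral>\<^sup>+p. I p q \<partial>lborel) = indicator R q * (ennreal (norm (g q)) *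
         (\<integral>\<^sup>+p. ennreal (norm (k p q)) * indicator ({fst q<..<B} \<times> {snd q<..<D}) p \<partial>lborel))"
        unfolding I_eq
        by (simp add: nn_integral_cmult)
      also have "\<dots> \<le> indicator R q * (ennreal (norm (g q)) * ennreal K)"
        using bound[of "fst q" "snd q"]
        by (cases "q \<in> R") (auto simp: R_def intro!: mult_left_mono)
      finally show "(\<integral>\<^sup>+p. I p q \<partial>lborel) \<le> ennreal K * (ennreal (norm (g q)) * indicator R q)"
        by (simp add: mult_ac)
    qed
    also have "\<dots> = ennreal K * L1_norm A B C D \<psi>"
      using ae unfolding R_def
      by (subst nn_integral_cmult) (auto simp: L1_norm_lborel[OF g] simp flip: R_def)
    finally show ?thesis .
  qed
  have "L1_norm A B C D (T \<psi>) = (\<integral>\<^sup>+p. ennreal (norm (S p)) * indicator R p \<partial>lborel)"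
    using TS unfolding R_def by (intro L1_norm_lborel) auto
  also have "\<dots> \<le> (\<integral>\<^sup>+p. (\<integral>\<^sup>+q. I p q \<partial>lborel) \<partial>lborel)"
    by (intro nn_integral_mono S_le)
  also note tonelli
  finally show le: "L1_norm A B C D (T \<psi>) \<le> ennreal K * L1_norm A B C D \<psi>" .
  have fin: "ennreal K * L1_norm A B C D \<psi> < \<infinity>"
    using \<psi>2 by (simp add: ennreal_mult_less_top)
  have "S \<in> borel_measurable (lebesgue_on R)"
    by (intro measurable_restrict_space1 measurable_completion) simp
  then have "T \<psi> \<in> borel_measurable (lebesgue_on R)"
    by (subst measurable_cong[of _ _ S]) (auto simp: TS)
  then show "T \<psi> \<in> L1_space A B C D"
    using le_less_trans[OF le fin] by (simp add: L1_space_def R_def)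
  \<comment> \<open>A finite double integral has a finite inner integral for almost every
    \<open>p\<close>, and there the integrand of the operator is absolutely integrable.\<close>
  have "AE p in lborel. (\<integral>\<^sup>+q. I p q \<partial>lborel) \<noteq> \<infinity>"
  proof (rule nn_integral_noteq_infinite)
    show "(\<integral>\<^sup>+p. (\<integral>\<^sup>+q. I p q \<partial>lborel) \<partial>lborel) \<noteq> \<infinity>"
      using le_less_trans[OF tonelli fin] by simp
  qed measurable
  then have "AE p in lborel. p \<in> R \<longrightarrow>
    (\<lambda>q. k p q * \<psi> q) absolutely_integrable_on ({A<..<fst p} \<times> {C<..<snd p})"
  proof eventually_elim
    case (elim p)
    show ?case
    proof
      assume p: "p \<in> R"
      let ?Q = "{A<..<fst p} \<times> {C<..<snd p}"
      have "integrable lborel (\<lambda>q. indicator ?Q q *\<^sub>R (k p q * g q))"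
      proof (rule integrableI_bounded)
        have "(\<integral>\<^sup>+q. ennreal (norm (indicator ?Q q *\<^sub>R (k p q * g q))) \<partial>lborel) = (\<integral>\<^sup>+q. I p q \<partial>lborel)"
          using p by (intro nn_integral_cong) (auto simp: I_def indicator_def)
        then show "(\<integral>\<^sup>+q. ennreal (norm (indicator ?Q q *\<^sub>R (k p q * g q))) \<partial>lborel) < \<infinity>"
          using elim by (simp add: less_top)
      qed measurable
      moreover have "AE q in lborel. indicator ?Q q *\<^sub>R (k p q * \<psi> q) = indicator ?Q q *\<^sub>R (k p q * g q)"
        using ae by eventually_elim (use p in \<open>auto simp: indicator_def R_def\<close>)
      ultimately show "(\<lambda>q. k p q * \<psi> q) absolutely_integrable_on ?Q"
        unfolding set_integrable_def by (subst integral_completion_AE_cong(2)) auto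
    qed
  qed
  from AE_completion[OF this]
  show "AE (X, Y) in lebesgue_on R.
      (\<lambda>q. k (X, Y) q * \<psi> q) absolutely_integrable_on ({A<..<X} \<times> {C<..<Y})"
    by (subst AE_restrict_space_iff) (auto simp: split_beta)
qed

subsection \<open>Pochhammer symbols and the Gamma function\<close>

lemma norm_pochhammer_le:
  fixes z :: complex
  shows "norm (pochhammer z n) \<le> (1 + norm z) ^ n * fact n"
proof (induction n)
  case (Suc n)
  have "norm (z + of_nat n) \<le> norm z + real n"
    using norm_triangle_ineq[of z "of_nat n"] by simp
  also have "\<dots> \<le> (1 + norm z) * real (Suc n)"
    by (simp add: algebra_simps)
  finally have "norm (pochhammer z n) * norm (z + of_nat n)
      \<le> ((1 + norm z) ^ n * fact n) * ((1 + norm z) * real (Suc n))"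
    by (intro mult_mono Suc) auto
  then show ?case
    by (simp add: pochhammer_Suc norm_mult mult_ac del: of_nat_Suc)
qed auto

text \<open>Each factor satisfies |z + n| >= Re z + n >= min(1, Re z) (n + 1). With the preceding
  upper bound, Pochhammer symbols are factorials up to geometric factors.\<close>

lemma norm_pochhammer_ge:
  fixes z :: complex
  assumes z: "Re z > 0"
  shows "norm (pochhammer z n) \<ge> min 1 (Re z) ^ n * fact n"
proof (induction n)
  case (Suc n)
  have "min 1 (Re z) * real (Suc n) = min 1 (Re z) + min 1 (Re z) * real n"
    by (simp add: algebra_simps)
  also have "\<dots> \<le> Re z + 1 * real n"
    by (intro add_mono mult_right_mono) auto
  also have "\<dots> \<le> norm (z + of_nat n)"
    using complex_Re_le_cmod[of "z + of_nat n"] by simp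
  finally have "(min 1 (Re z) ^ n * fact n) * (min 1 (Re z) * real (Suc n))
      \<le> norm (pochhammer z n) * norm (z + of_nat n)"
    using z by (intro mult_mono Suc) auto
  then show ?case
    by (simp add: pochhammer_Suc norm_mult mult_ac del: of_nat_Suc)
qed auto

text \<open>A binomial coefficient is at most 2^(m + n). This separates s from r in
  \<open>pochhammer \<gamma>2 (s + r)\<close>, the factor that couples the two sums.\<close>

lemma fact_add_le: "fact (m + n) \<le> (2 ^ (m + n) * fact m * fact n :: real)"
proof -
  have "real (m + n choose m) \<le> 2 ^ (m + n)"
    using binomial_le_pow2[of "m + n" m] by (metis of_nat_le_iff of_nat_numeral of_nat_power)
  then have "fact (m + n) / (fact m * fact n) \<le> (2 ^ (m + n) :: real)"
    by (simp add: binomial_fact)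
  then show ?thesis by (simp add: divide_simps mult_ac)
qed

text \<open>For k >= 1 the term is at most 1/(x + k - 1) - 1/(x + k), which telescopes. Uniformity
  in \<open>n\<close> permits the limit in Euler's product.\<close>

lemma sum_inverse_squares_le:
  fixes x :: real
  assumes x: "x > 0"
  shows "(\<Sum>k\<le>n. 1 / (x + real k) ^ 2) \<le> 1 / x ^ 2 + 1 / x"
proof -
  have "(\<Sum>k\<le>n. 1 / (x + real k) ^ 2) \<le> 1 / x ^ 2 + 1 / x - 1 / (x + real n)"
  proof (induction n)
    case (Suc n)
    have "1 / (x + real (Suc n)) ^ 2 \<le> 1 / ((x + real n) * (x + real (Suc n)))"
      using x by (intro divide_left_mono) (auto simp: power2_eq_square intro!: mult_right_mono)
    also have "\<dots> = 1 / (x + real n) - 1 / (x + real (Suc n))"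
      using x by (simp add: field_simps)
    finally show ?case using Suc by simp
  qed (use x in auto)
  also have "\<dots> \<le> 1 / x ^ 2 + 1 / x" using x by simp
  finally show ?thesis .
qed

text \<open>
  Euler's product: \<open>|\<Gamma>(x) / \<Gamma>(x + iy)|\<^sup>2\<close> is the product of the factors
  \<open>1 + y\<^sup>2 / (x + k)\<^sup>2\<close>, which \<open>1 + u \<le> exp u\<close> bounds.
\<close>

lemma norm_rGamma_le:
  fixes z :: complex
  assumes z: "Re z > 0"
  shows "norm (rGamma z) \<le> exp ((Im z) ^ 2 * (1 / (Re z) ^ 2 + 1 / Re z) / 2) / Gamma (Re z)"
proof -
  define x y where "x = Re z" and "y = Im z"
  have x: "x > 0" using z by (simp add: x_def)
  define E where "E = exp (y ^ 2 * (1 / x ^ 2 + 1 / x) / 2)"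
  have factor: "norm (z + of_nat k) \<le> (x + real k) * exp (y ^ 2 * (1 / (x + real k) ^ 2) / 2)" for k
  proof (rule power2_le_imp_le)
    have "(norm (z + of_nat k)) ^ 2 = (x + real k) ^ 2 * (1 + y ^ 2 * (1 / (x + real k) ^ 2))"
      using x by (simp add: cmod_power2 x_def[symmetric] y_def[symmetric] field_simps)
    also have "\<dots> \<le> (x + real k) ^ 2 * exp (y ^ 2 * (1 / (x + real k) ^ 2))"
      by (intro mult_left_mono exp_ge_add_one_self) auto
    also have "\<dots> = ((x + real k) * exp (y ^ 2 * (1 / (x + real k) ^ 2) / 2)) ^ 2"
      by (simp add: power_mult_distrib flip: exp_double)
    finally show "(norm (z + of_nat k)) ^ 2 \<le> ((x + real k) * exp (y ^ 2 * (1 / (x + real k) ^ 2) / 2)) ^ 2" .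
  qed (use x in auto)
  have "norm (pochhammer z (Suc n)) \<le> pochhammer x (Suc n) * E" for n
  proof -
    have "norm (pochhammer z (Suc n)) = (\<Prod>k\<le>n. norm (z + of_nat k))"
      by (simp add: pochhammer_Suc_prod prod_norm atMost_atLeast0)
    also have "\<dots> \<le> (\<Prod>k\<le>n. (x + real k) * exp (y ^ 2 * (1 / (x + real k) ^ 2) / 2))"
      by (intro prod_mono conjI factor norm_ge_zero)
    also have "\<dots> = pochhammer x (Suc n) * exp (y ^ 2 * (\<Sum>k\<le>n. 1 / (x + real k) ^ 2) / 2)"
      by (simp add: pochhammer_Suc_prod prod.distrib exp_sum[symmetric] atMost_atLeast0
          sum_distrib_left sum_divide_distrib)
    also have "\<dots> \<le> pochhammer x (Suc n) * E"
      unfolding E_def using sum_inverse_squares_le[OF x, of n] x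
      by (intro mult_left_mono) (auto intro!: divide_right_mono mult_left_mono pochhammer_nonneg)
    finally show ?thesis .
  qed
  \<comment> \<open>The approximants of 1/\<Gamma> divide by n! and n^z; the modulus of n^z depends
    on Re z alone, so the denominators agree.\<close>
  then have "norm (rGamma_series z n) \<le> rGamma_series x n * E" for n
    by (simp add: rGamma_series_def norm_divide norm_mult x_def divide_right_mono)
  then have "norm (rGamma z) \<le> rGamma x * E"
    by (intro LIMSEQ_le[OF tendsto_norm[OF rGamma_series_LIMSEQ]
      tendsto_mult[OF rGamma_series_LIMSEQ tendsto_const]] exI[of _ 0]) blast
  also have "\<dots> = E / Gamma x"
    by (simp only: rGamma_inverse_Gamma divide_inverse mult.commute)
  finally show ?thesis
    by (simp only: E_def x_def y_def)
qed

text \<open>Euler's integral is restricted to [L, L + 1], where both factors of the integrand are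
  bounded below by endpoint values. Since \<open>L\<close> is arbitrary, \<Gamma> outgrows every
  exponential.\<close>

lemma Gamma_real_ge_power:
  fixes L x :: real
  assumes L: "L > 0" and x: "x \<ge> 1"
  shows "Gamma x \<ge> L powr (x - 1) * exp (- (L + 1))"
proof -
  let ?f = "\<lambda>t. t powr (x - 1) / exp t"
  have f: "?f integrable_on {L..L + 1}"
    using L by (intro integrable_continuous_real continuous_intros) auto
  have "((\<lambda>t. L powr (x - 1) * exp (- (L + 1))) has_integral
      (L + 1 - L) *\<^sub>R (L powr (x - 1) * exp (- (L + 1)))) {L..L + 1}"
    using has_integral_const_real[of "L powr (x - 1) * exp (- (L + 1))" L "L + 1"] L by simp
  then have "(L + 1 - L) *\<^sub>R (L powr (x - 1) * exp (- (L + 1))) \<le> integral {L..L + 1} ?f"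
  proof (rule has_integral_le[OF _ integrable_integral[OF f]])
    fix t assume t: "t \<in> {L..L + 1}"
    have "L powr (x - 1) * exp (- (L + 1)) \<le> t powr (x - 1) * exp (- t)"
      using t L x by (intro mult_mono powr_mono2) auto
    then show "L powr (x - 1) * exp (- (L + 1)) \<le> t powr (x - 1) / exp t"
      by (simp add: exp_minus divide_inverse)
  qed
  also have "\<dots> \<le> Gamma x"
    using L x by (intro has_integral_subset_le[OF _ integrable_integral[OF f] Gamma_integral_real]) auto
  finally show ?thesis by simp
qed

lemma summable_rGamma_power:
  fixes \<rho> \<Upsilon> :: complex and M :: real
  assumes \<rho>: "Re \<rho> > 0" and \<Upsilon>: "Re \<Upsilon> > 0" and M: "M \<ge> 0"
  shows "summable (\<lambda>r. M ^ r * norm (rGamma (\<rho> + \<Upsilon> * of_nat r)))"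
proof -
  \<comment> \<open>Along the ray |Im| is at most \<open>q\<close> times the real part x, so the
    imaginary part costs a factor exp (h + h x). The lower bound for \<Gamma> with L = exp l and l =
    h + m cancels exp (h x) and leaves exp (- m x). As m Re \<Upsilon> = M + 1, this absorbs M^r and
    still leaves exp (- r); \<open>c\<close> collects the constants.\<close>
  define x where "x = (\<lambda>r. Re \<rho> + Re \<Upsilon> * real r)"
  define q where "q = \<bar>Im \<rho>\<bar> / Re \<rho> + \<bar>Im \<Upsilon>\<bar> / Re \<Upsilon>"
  define m where "m = (M + 1) / Re \<Upsilon>"
  define h where "h = q ^ 2 / 2"
  define l where "l = h + m"
  define c where "c = h + exp l + 1 + l"
  have bound: "M ^ r * norm (rGamma (\<rho> + \<Upsilon> * of_nat r)) \<le> exp c * exp (- 1) ^ r" if x1: "x r \<ge> 1" for r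
  proof -
    let ?z = "\<rho> + \<Upsilon> * of_nat r" and ?x = "x r"
    have Re: "Re ?z = ?x" by (simp add: x_def)
    have "\<bar>Im ?z\<bar> \<le> \<bar>Im \<rho>\<bar> + \<bar>Im \<Upsilon>\<bar> * real r"
      using abs_triangle_ineq[of "Im \<rho>" "Im \<Upsilon> * real r"] by (simp add: abs_mult)
    also have "\<dots> \<le> \<bar>Im \<rho>\<bar> / Re \<rho> * ?x + \<bar>Im \<Upsilon>\<bar> / Re \<Upsilon> * ?x"
    proof (rule add_mono)
      have "\<bar>Im \<rho>\<bar> / Re \<rho> * Re \<rho> \<le> \<bar>Im \<rho>\<bar> / Re \<rho> * ?x"
        using \<rho> \<Upsilon> by (intro mult_left_mono) (auto simp: x_def)
      then show "\<bar>Im \<rho>\<bar> \<le> \<bar>Im \<rho>\<bar> / Re \<rho> * ?x" using \<rho> by simp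
      have "\<bar>Im \<Upsilon>\<bar> / Re \<Upsilon> * (Re \<Upsilon> * real r) \<le> \<bar>Im \<Upsilon>\<bar> / Re \<Upsilon> * ?x"
        using \<rho> \<Upsilon> by (intro mult_left_mono) (auto simp: x_def)
      then show "\<bar>Im \<Upsilon>\<bar> * real r \<le> \<bar>Im \<Upsilon>\<bar> / Re \<Upsilon> * ?x" using \<Upsilon> by simp
    qed
    finally have "\<bar>Im ?z\<bar> \<le> \<bar>q * ?x\<bar>" by (simp add: q_def algebra_simps)
    then have "(Im ?z) ^ 2 \<le> (q * ?x) ^ 2" by (simp only: abs_le_square_iff)
    then have "(Im ?z) ^ 2 * (1 / ?x ^ 2 + 1 / ?x) / 2 \<le> (q * ?x) ^ 2 * (1 / ?x ^ 2 + 1 / ?x) / 2"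
      using x1 by (intro divide_right_mono mult_right_mono) auto
    also have "\<dots> = h + h * ?x"
      using x1 by (simp add: h_def power_mult_distrib field_simps power2_eq_square)
    finally have E: "exp ((Im ?z) ^ 2 * (1 / ?x ^ 2 + 1 / ?x) / 2) \<le> exp (h + h * ?x)"
      by simp
    have G: "exp (l * (?x - 1) - (exp l + 1)) \<le> Gamma ?x"
    proof -
      have "exp (l * (?x - 1) - (exp l + 1)) = exp l powr (?x - 1) * exp (- (exp l + 1))"
        by (simp add: powr_def exp_add[symmetric] mult.commute)
      then show ?thesis
        using Gamma_real_ge_power[of "exp l" ?x] x1 by (simp del: minus_add_distrib)
    qed
    have "norm (rGamma ?z) \<le> exp ((Im ?z) ^ 2 * (1 / ?x ^ 2 + 1 / ?x) / 2) / Gamma ?x"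
      using norm_rGamma_le[of ?z] x1 unfolding Re by simp
    also have "\<dots> \<le> exp (h + h * ?x) / exp (l * (?x - 1) - (exp l + 1))"
      by (intro frac_le E G) auto
    finally have N: "norm (rGamma ?z) \<le> exp (h + h * ?x - (l * (?x - 1) - (exp l + 1)))"
      by (simp add: exp_diff)
    have "M \<le> exp M" using exp_ge_add_one_self[of M] by linarith
    then have "M ^ r \<le> exp (real r * M)"
      using M by (simp add: power_mono exp_of_nat_mult)
    then have "M ^ r * norm (rGamma ?z) \<le> exp (real r * M) *
        exp (h + h * ?x - (l * (?x - 1) - (exp l + 1)))"
      by (intro mult_mono N) auto
    also have "\<dots> = exp (c + real r * M - m * ?x)"
    proof -
      have "real r * M + (h + h * ?x - ((h + m) * (?x - 1) - (exp l + 1))) =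
          h + exp l + 1 + (h + m) + real r * M - m * ?x"
        by (simp add: algebra_simps)
      then show ?thesis
        unfolding exp_add[symmetric] c_def l_def[symmetric] by (rule arg_cong)
    qed
    also have "\<dots> \<le> exp (c - real r)"
    proof -
      have "m * (Re \<Upsilon> * real r) \<le> m * ?x"
        using \<rho> \<Upsilon> M by (intro mult_left_mono) (auto simp: x_def m_def)
      moreover have "m * (Re \<Upsilon> * real r) = (M + 1) * real r"
        using \<Upsilon> by (simp add: m_def)
      ultimately have "real r * M - m * ?x \<le> - real r"
        by (simp only: distrib_right mult_1 mult.commute[of _ M])
      then show ?thesis by simp
    qed
    also have "\<dots> = exp c * exp (- 1) ^ r"
      by (simp add: exp_of_nat_mult[symmetric] exp_add[symmetric])
    finally show ?thesis .
  qed
  have "eventually (\<lambda>r. x r \<ge> 1) sequentially"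
    using eventually_ge_at_top[of "nat \<lceil>1 / Re \<Upsilon>\<rceil>"]
  proof eventually_elim
    case (elim r)
    then have "1 / Re \<Upsilon> \<le> real r" by linarith
    then show ?case using \<rho> \<Upsilon> by (simp add: x_def field_simps)
  qed
  then have "eventually (\<lambda>r. norm (M ^ r * norm (rGamma (\<rho> + \<Upsilon> * of_nat r))) \<le> exp c * exp (- 1) ^ r) sequentially"
    by eventually_elim (use bound M in simp)
  then show ?thesis
    by (rule summable_comparison_test_ev) (intro summable_mult summable_geometric, simp)
qed

subsection \<open>The bivariate function and the kernel\<close>

definition HK_term ::
  "complex \<Rightarrow> complex \<Rightarrow> complex \<Rightarrow> complex \<Rightarrow> complex \<Rightarrow> complex \<Rightarrow> complex
    \<Rightarrow> complex \<Rightarrow> (nat \<Rightarrow> complex) \<Rightarrow> nat \<Rightarrow> nat \<Rightarrow> complex" where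
  "HK_term \<kappa> \<rho> \<Upsilon> \<gamma>1 \<gamma>2 \<gamma>3 \<gamma>4 X P s r =
    pochhammer \<gamma>1 (2 * s) * pochhammer \<gamma>2 (s + r) * X ^ s * P r /
      (pochhammer \<gamma>3 s * pochhammer \<gamma>4 s * Gamma (\<kappa> + of_nat s) * Gamma (\<rho> + \<Upsilon> * of_nat r)
        * fact r * fact s)"

text \<open>Up to geometric factors, (2s)! is at most s!^2 and (s + r)! at most s! r!, so the
  numerator contributes s!^3 r!. In the denominator \<gamma>3, \<gamma>4 and \<kappa> supply s!^3,
  and the explicit factorials r! s!; what is left is 1/s!.\<close>

lemma norm_HK_term_le:
  fixes \<gamma>1 \<gamma>2 \<gamma>3 \<gamma>4 \<kappa> \<rho> \<Upsilon> X :: complex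
  assumes "Re \<gamma>3 > 0" "Re \<gamma>4 > 0" "Re \<kappa> > 0"
    and X: "norm X \<le> a" and P: "\<And>r. norm (P r) \<le> b ^ r"
  defines "c \<equiv> min 1 (Re \<gamma>3) * min 1 (Re \<gamma>4) * min 1 (Re \<kappa>)"
  shows "norm (HK_term \<kappa> \<rho> \<Upsilon> \<gamma>1 \<gamma>2 \<gamma>3 \<gamma>4 X P s r) \<le>
    norm (rGamma \<kappa>) * ((((1 + norm \<gamma>1) ^ 2 * 4 * (1 + norm \<gamma>2) * 2 * a / c) ^ s / fact s) *
      (((1 + norm \<gamma>2) * 2 * b) ^ r * norm (rGamma (\<rho> + \<Upsilon> * of_nat r))))"
proof -
  have c: "min 1 (Re \<gamma>3) > 0" "min 1 (Re \<gamma>4) > 0" "min 1 (Re \<kappa>) > 0"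
    using assms by auto
  have a: "a \<ge> 0" using X norm_ge_zero[of X] by linarith
  have b: "b ^ r \<ge> 0" using P[of r] norm_ge_zero[of "P r"] by linarith
  have e8: "(8 :: real) ^ s = 4 ^ s * 2 ^ s" by (simp flip: power_mult_distrib)
  \<comment> \<open>Pure regrouping in abstract reals: F and H stand for s! and r!, G and N for the
    moduli of 1/\<Gamma>(\<kappa>) and 1/\<Gamma>(\<rho> + \<Upsilon> r).\<close>
  have eq: "((x ^ (2 * s) * (4 ^ s * F * F)) * (y ^ (s + r) * (2 ^ (s + r) * F * H)) * a ^ s * b ^ r) *
      (inverse (p ^ s * F) * inverse (q ^ s * F) * (G * inverse (w ^ s * F)) * N) * inverse (H * F) =
    G * (((x ^ 2 * 4 * y * 2 * a / (p * q * w)) ^ s / F) * ((y * 2 * b) ^ r * N))"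
    if "p > 0" "q > 0" "w > 0" "F > 0" "H > 0" for x y p q w F H G N :: real
    using that by (simp add: power_mult power_add power_mult_distrib power_divide divide_simps e8)
  have g1: "norm (pochhammer \<gamma>1 (2 * s)) \<le> (1 + norm \<gamma>1) ^ (2 * s) * (4 ^ s * fact s * fact s)"
  proof -
    have "fact (2 * s) \<le> (4 ^ s * fact s * fact s :: real)"
      using fact_add_le[of s s] by (simp add: mult_2[symmetric] power_mult)
    then show ?thesis
      by (intro order_trans[OF norm_pochhammer_le] mult_left_mono) auto
  qed
  have g2: "norm (pochhammer \<gamma>2 (s + r)) \<le> (1 + norm \<gamma>2) ^ (s + r) * (2 ^ (s + r) * fact s * fact r)"
    by (intro order_trans[OF norm_pochhammer_le] mult_left_mono fact_add_le) auto
  have inv: "inverse (norm (pochhammer z s)) \<le> inverse (min 1 (Re z) ^ s * fact s)" if "Re z > 0" for z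
    using norm_pochhammer_ge[OF that, of s] that by (intro le_imp_inverse_le) auto
  \<comment> \<open>The functional equation turns 1/\<Gamma>(\<kappa> + s) into 1/\<Gamma>(\<kappa>)
    over the Pochhammer symbol of \<kappa>, the source of the third s! in the denominator.\<close>
  have "norm (rGamma (\<kappa> + of_nat s)) = norm (rGamma \<kappa>) * inverse (norm (pochhammer \<kappa> s))"
  proof -
    have "pochhammer \<kappa> s \<noteq> 0"
      using norm_pochhammer_ge[OF assms(3), of s] c(3)
      by (metis fact_gt_zero mult_pos_pos norm_zero not_less zero_less_power)
    then show ?thesis
      using pochhammer_rGamma[of \<kappa> s] by (simp add: norm_mult)
  qed
  then have Gk: "norm (rGamma (\<kappa> + of_nat s)) \<le> norm (rGamma \<kappa>) * inverse (min 1 (Re \<kappa>) ^ s * fact s)"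
    using inv[OF assms(3)] by (simp add: mult_left_mono)
  have "norm (HK_term \<kappa> \<rho> \<Upsilon> \<gamma>1 \<gamma>2 \<gamma>3 \<gamma>4 X P s r) =
      (norm (pochhammer \<gamma>1 (2 * s)) * norm (pochhammer \<gamma>2 (s + r)) * norm X ^ s * norm (P r)) *
      (inverse (norm (pochhammer \<gamma>3 s)) * inverse (norm (pochhammer \<gamma>4 s)) *
        norm (rGamma (\<kappa> + of_nat s)) * norm (rGamma (\<rho> + \<Upsilon> * of_nat r))) * inverse (fact r * fact s)"
    by (simp add: HK_term_def divide_inverse norm_mult norm_power norm_inverse
        rGamma_inverse_Gamma[symmetric] mult_ac)
  also have "\<dots> \<le> (((1 + norm \<gamma>1) ^ (2 * s) * (4 ^ s * fact s * fact s)) *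
        ((1 + norm \<gamma>2) ^ (s + r) * (2 ^ (s + r) * fact s * fact r)) * a ^ s * b ^ r) *
      (inverse (min 1 (Re \<gamma>3) ^ s * fact s) * inverse (min 1 (Re \<gamma>4) ^ s * fact s) *
        (norm (rGamma \<kappa>) * inverse (min 1 (Re \<kappa>) ^ s * fact s)) *
        norm (rGamma (\<rho> + \<Upsilon> * of_nat r))) * inverse (fact r * fact s)"
    by (intro mult_right_mono[where c = "inverse (fact r * fact s)"] mult_mono g1 g2 Gk inv assms(1,2) P power_mono X order_refl)
      (use a b c in \<open>auto intro!: mult_nonneg_nonneg\<close>)
  also have "\<dots> = norm (rGamma \<kappa>) * ((((1 + norm \<gamma>1) ^ 2 * 4 * (1 + norm \<gamma>2) * 2 * a / c) ^ s / fact s) *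
      (((1 + norm \<gamma>2) * 2 * b) ^ r * norm (rGamma (\<rho> + \<Upsilon> * of_nat r))))"
    unfolding c_def by (rule eq) (use c in auto)
  finally show ?thesis .
qed

text \<open>The majorant is a product of a term in s and a term in r, so the iterated sum is at most
  an exponential series times the series of \<open>summable_rGamma_power\<close>. Taking for
  \<open>P\<close> any sequence with a geometric bound makes the estimate uniform in the point and
  free of branches.\<close>

lemma HK_ML_bounded:
  fixes \<gamma>1 \<gamma>2 \<gamma>3 \<gamma>4 \<kappa> \<rho> \<Upsilon> :: complex and a b :: real
  assumes "Re \<gamma>3 > 0" "Re \<gamma>4 > 0" "Re \<kappa> > 0" and \<rho>: "Re \<rho> > 0" and \<Upsilon>: "Re \<Upsilon> > 0"
    and b: "b \<ge> 0"
  obtains M :: real where "M \<ge> 0"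
    "\<And>X P. norm X \<le> a \<Longrightarrow> (\<And>r. norm (P r) \<le> b ^ r) \<Longrightarrow>
      norm (HK_ML \<kappa> \<rho> \<Upsilon> \<gamma>1 \<gamma>2 \<gamma>3 \<gamma>4 X P) \<le> M"
proof (cases "a \<ge> 0")
  \<comment> \<open>No \<open>X\<close> has norm at most a negative \<open>a\<close>, so the bound
    is vacuous.\<close>
  case False
  show ?thesis
  proof (rule that[of 0])
    fix X :: complex assume "norm X \<le> a"
    then show "norm (HK_ML \<kappa> \<rho> \<Upsilon> \<gamma>1 \<gamma>2 \<gamma>3 \<gamma>4 X P) \<le> 0" for P
      using False norm_ge_zero[of X] by linarith
  qed simp
next
  case a: True
  define c where "c = min 1 (Re \<gamma>3) * min 1 (Re \<gamma>4) * min 1 (Re \<kappa>)"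
  define u where "u = (\<lambda>s. ((1 + norm \<gamma>1) ^ 2 * 4 * (1 + norm \<gamma>2) * 2 * a / c) ^ s / fact s)"
  define v where "v = (\<lambda>r. ((1 + norm \<gamma>2) * 2 * b) ^ r * norm (rGamma (\<rho> + \<Upsilon> * of_nat r)))"
  have c: "c > 0" using assms by (simp add: c_def)
  have u: "summable u"
    using summable_exp[of "(1 + norm \<gamma>1) ^ 2 * 4 * (1 + norm \<gamma>2) * 2 * a / c"]
    by (simp add: u_def divide_inverse mult.commute)
  have v: "summable v"
    unfolding v_def using b by (intro summable_rGamma_power \<rho> \<Upsilon>) auto
  have u0: "u s \<ge> 0" for s using a c by (auto simp: u_def)
  have v0: "v r \<ge> 0" for r using b by (auto simp: v_def)
  show ?thesis
  proof (rule that)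
    show "norm (rGamma \<kappa>) * (suminf u * suminf v) \<ge> 0"
      by (intro mult_nonneg_nonneg suminf_nonneg u v u0 v0 norm_ge_zero)
    fix X :: complex and P :: "nat \<Rightarrow> complex"
    assume X: "norm X \<le> a" and P: "\<And>r. norm (P r) \<le> b ^ r"
    have le: "norm (HK_term \<kappa> \<rho> \<Upsilon> \<gamma>1 \<gamma>2 \<gamma>3 \<gamma>4 X P s r) \<le> norm (rGamma \<kappa>) * (u s * v r)" for s r
      using norm_HK_term_le[OF assms(1-3) X P, of \<rho> \<Upsilon> \<gamma>1 \<gamma>2 s r] by (simp add: u_def v_def c_def)
    have inner: "norm (\<Sum>r. HK_term \<kappa> \<rho> \<Upsilon> \<gamma>1 \<gamma>2 \<gamma>3 \<gamma>4 X P s r) \<le> norm (rGamma \<kappa>) * (u s * suminf v)" for s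
      using norm_suminf_le[OF le summable_mult[OF summable_mult[OF v]]]
      by (simp add: suminf_mult v)
    have "norm (\<Sum>s. \<Sum>r. HK_term \<kappa> \<rho> \<Upsilon> \<gamma>1 \<gamma>2 \<gamma>3 \<gamma>4 X P s r) \<le> norm (rGamma \<kappa>) * (suminf u * suminf v)"
      using norm_suminf_le[OF inner summable_mult[OF summable_mult2[OF u]]]
      by (simp add: suminf_mult summable_mult2 suminf_mult2[symmetric] u)
    then show "norm (HK_ML \<kappa> \<rho> \<Upsilon> \<gamma>1 \<gamma>2 \<gamma>3 \<gamma>4 X P) \<le> norm (rGamma \<kappa>) * (suminf u * suminf v)"
      by (simp add: HK_ML_def HK_term_def)
  qed
qed

lemma nn_integral_powr_shift:
  fixes a t B :: real
  assumes a: "a > 0" and "t < B"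
  shows "(\<integral>\<^sup>+x. ennreal ((x - t) powr (a - 1)) * indicator {t<..<B} x \<partial>lborel) = ennreal ((B - t) powr a / a)"
proof -
  have "(\<integral>\<^sup>+x. ennreal ((x - t) powr (a - 1)) * indicator {t<..<B} x \<partial>lborel) =
      (\<integral>\<^sup>+x. ennreal (x powr (a - 1)) * indicator {t<..<B} (t + x) \<partial>lborel)"
    by (subst nn_integral_real_affine[where c = 1 and t = t]) auto
  \<comment> \<open>Passing to the closed interval changes a null set; the exponent exceeds -1, so
    the singularity at 0 is integrable.\<close>
  also have "\<dots> = (\<integral>\<^sup>+x. ennreal (indicator {0..B - t} x * x powr (a - 1)) \<partial>lborel)"
    using AE_lborel_singleton[of 0] AE_lborel_singleton[of "B - t"]
    by (intro nn_integral_cong_AE, eventually_elim) (auto simp: indicator_def)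
  also have "\<dots> = ennreal ((B - t) powr a / a)"
    using has_integral_powr_from_0[of "a - 1" "B - t"] assms
    by (intro nn_integral_has_integral_lebesgue) auto
  finally show ?thesis .
qed

lemma measurable_HK_kernel:
  "(\<lambda>(p, q). HK_kernel \<kappa> \<rho> \<Upsilon> \<nu>1 \<omega> \<gamma>1 \<gamma>2 \<gamma>3 \<gamma>4 p q) \<in> borel_measurable (borel \<Otimes>\<^sub>M borel)"
proof -
  have [measurable]: "(\<lambda>x::(real \<times> real) \<times> (real \<times> real). fst (fst x)) \<in> borel_measurable borel"
    "(\<lambda>x::(real \<times> real) \<times> (real \<times> real). snd (fst x)) \<in> borel_measurable borel"
    "(\<lambda>x::(real \<times> real) \<times> (real \<times> real). fst (snd x)) \<in> borel_measurable borel"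
    "(\<lambda>x::(real \<times> real) \<times> (real \<times> real). snd (snd x)) \<in> borel_measurable borel"
    by (auto intro!: borel_measurable_continuous_onI continuous_intros)
  show ?thesis
    unfolding HK_kernel_def HK_ML_def split_beta borel_prod by measurable
qed

lemma HK_kernel_nn_integral_bounded:
  fixes A B C D :: real
    and \<gamma>1 \<gamma>2 \<gamma>3 \<gamma>4 \<kappa> \<rho> \<Upsilon> \<nu>1 \<omega> :: complex
  assumes "Re \<gamma>3 > 0" and "Re \<gamma>4 > 0"
    and \<kappa>: "Re \<kappa> > 0" and \<rho>: "Re \<rho> > 0" and \<Upsilon>: "Re \<Upsilon> > 0"
  obtains K :: real where "K \<ge> 0"
    "\<And>t \<Omega>. t \<in> {A<..<B} \<Longrightarrow> \<Omega> \<in> {C<..<D} \<Longrightarrow>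
      (\<integral>\<^sup>+p. ennreal (norm (HK_kernel \<kappa> \<rho> \<Upsilon> \<nu>1 \<omega> \<gamma>1 \<gamma>2 \<gamma>3 \<gamma>4 p (t, \<Omega>))) *
        indicator ({t<..<B} \<times> {\<Omega><..<D}) p \<partial>lborel) \<le> ennreal K"
proof -
  \<comment> \<open>A power of a positive base has modulus governed by the real part of the
    exponent, and Y - \<Omega> < D - C on the rectangle; hence the r-th value supplied to
    \<open>HK_ML\<close> is at most b^r.\<close>
  define b where "b = norm \<omega> * (D - C) powr Re \<Upsilon>"
  obtain M where M: "M \<ge> 0"
    "\<And>X P. norm X \<le> norm \<nu>1 * (B - A) \<Longrightarrow> (\<And>r. norm (P r) \<le> b ^ r) \<Longrightarrow>
      norm (HK_ML \<kappa> \<rho> \<Upsilon> \<gamma>1 \<gamma>2 \<gamma>3 \<gamma>4 X P) \<le> M"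
    by (rule HK_ML_bounded[of \<gamma>3 \<gamma>4 \<kappa> \<rho> \<Upsilon> b "norm \<nu>1 * (B - A)" \<gamma>1 \<gamma>2])
      (use assms in \<open>auto simp: b_def\<close>)
  show ?thesis
  proof (rule that)
    \<comment> \<open>The kernel's majorant is a product in X and Y, so its integral factors;
      replacing B - t and D - \<Omega> by the full side lengths removes the dependence on (t,
      \<Omega>).\<close>
    show "M * ((B - A) powr Re \<kappa> / Re \<kappa> * ((D - C) powr Re \<rho> / Re \<rho>)) \<ge> 0"
      using M \<kappa> \<rho> by simp
    fix t \<Omega> assume t: "t \<in> {A<..<B}" and \<Omega>: "\<Omega> \<in> {C<..<D}"
    let ?f = "\<lambda>X. ennreal ((X - t) powr (Re \<kappa> - 1)) * indicator {t<..<B} X"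
    let ?g = "\<lambda>Y. ennreal ((Y - \<Omega>) powr (Re \<rho> - 1)) * indicator {\<Omega><..<D} Y"
    have k: "ennreal (norm (HK_kernel \<kappa> \<rho> \<Upsilon> \<nu>1 \<omega> \<gamma>1 \<gamma>2 \<gamma>3 \<gamma>4 (X, Y) (t, \<Omega>))) *
        indicator ({t<..<B} \<times> {\<Omega><..<D}) (X, Y) \<le> ennreal M * (?f X * ?g Y)" for X Y
    proof (cases "X \<in> {t<..<B} \<and> Y \<in> {\<Omega><..<D}")
      case True
      let ?E = "HK_ML \<kappa> \<rho> \<Upsilon> \<gamma>1 \<gamma>2 \<gamma>3 \<gamma>4 (\<nu>1 * of_real (X - t))
        (\<lambda>r. \<omega> ^ r * of_real (Y - \<Omega>) powr (\<Upsilon> * of_nat r))"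
      have E: "norm ?E \<le> M"
      proof (rule M(2))
        show "norm (\<nu>1 * of_real (X - t)) \<le> norm \<nu>1 * (B - A)"
          using True t by (auto simp: norm_mult simp flip: of_real_diff intro!: mult_left_mono)
        fix r
        have "norm (complex_of_real (Y - \<Omega>) powr (\<Upsilon> * of_nat r)) = ((Y - \<Omega>) powr Re \<Upsilon>) ^ r"
          using True by (simp add: norm_powr_real_powr powr_powr[symmetric] powr_realpow)
        also have "\<dots> \<le> ((D - C) powr Re \<Upsilon>) ^ r"
          using True \<Omega> \<Upsilon> by (intro power_mono powr_mono2) auto
        finally show "norm (\<omega> ^ r * of_real (Y - \<Omega>) powr (\<Upsilon> * of_nat r)) \<le> b ^ r"
          by (simp add: norm_mult norm_power b_def power_mult_distrib mult_left_mono)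
      qed
      have "norm (HK_kernel \<kappa> \<rho> \<Upsilon> \<nu>1 \<omega> \<gamma>1 \<gamma>2 \<gamma>3 \<gamma>4 (X, Y) (t, \<Omega>)) =
          (X - t) powr (Re \<kappa> - 1) * (Y - \<Omega>) powr (Re \<rho> - 1) * norm ?E"
        using True unfolding HK_kernel_def prod.case norm_mult
        by (simp add: norm_powr_real_powr del: of_real_diff)
      also have "\<dots> \<le> (X - t) powr (Re \<kappa> - 1) * (Y - \<Omega>) powr (Re \<rho> - 1) * M"
        by (intro mult_left_mono E) auto
      finally show ?thesis
        using True M(1) by (simp add: ennreal_mult[symmetric] mult_ac ennreal_leI)
    qed (auto simp: indicator_def)
    have "(\<integral>\<^sup>+p. ennreal (norm (HK_kernel \<kappa> \<rho> \<Upsilon> \<nu>1 \<omega> \<gamma>1 \<gamma>2 \<gamma>3 \<gamma>4 p (t, \<Omega>))) *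
        indicator ({t<..<B} \<times> {\<Omega><..<D}) p \<partial>lborel) \<le>
      (\<integral>\<^sup>+p. ennreal M * (?f (fst p) * ?g (snd p)) \<partial>(lborel \<Otimes>\<^sub>M lborel))"
      unfolding lborel_prod using k by (intro nn_integral_mono) force
    also have "\<dots> = ennreal M * (\<integral>\<^sup>+X. (\<integral>\<^sup>+Y. ?f X * ?g Y \<partial>lborel) \<partial>lborel)"
      by (subst nn_integral_cmult, measurable)
        (subst lborel.nn_integral_fst[symmetric], auto)
    also have "\<dots> = ennreal M * ((\<integral>\<^sup>+X. ?f X \<partial>lborel) * (\<integral>\<^sup>+Y. ?g Y \<partial>lborel))"
      by (subst nn_integral_cmult, measurable) (subst nn_integral_multc, auto)
    also have "\<dots> = ennreal (M * ((B - t) powr Re \<kappa> / Re \<kappa> * ((D - \<Omega>) powr Re \<rho> / Re \<rho>)))"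
      using t \<Omega> \<kappa> \<rho> M(1) by (simp add: nn_integral_powr_shift ennreal_mult[symmetric])
    also have "\<dots> \<le> ennreal (M * ((B - A) powr Re \<kappa> / Re \<kappa> * ((D - C) powr Re \<rho> / Re \<rho>)))"
      using t \<Omega> \<kappa> \<rho> M(1)
      by (intro ennreal_leI mult_left_mono mult_mono divide_right_mono powr_mono2) auto
    finally show "(\<integral>\<^sup>+p. ennreal (norm (HK_kernel \<kappa> \<rho> \<Upsilon> \<nu>1 \<omega> \<gamma>1 \<gamma>2 \<gamma>3 \<gamma>4 p (t, \<Omega>))) *
        indicator ({t<..<B} \<times> {\<Omega><..<D}) p \<partial>lborel)
      \<le> ennreal (M * ((B - A) powr Re \<kappa> / Re \<kappa> * ((D - C) powr Re \<rho> / Re \<rho>)))" .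
  qed
qed

text \<open>The integral of a non-integrable function is 0 by convention. The clause on absolute
  integrability therefore certifies that, for almost every (X, Y), the operator takes the value of a
  genuine double integral.\<close>

theorem theorem18:
  fixes A B C D :: real
    and \<gamma>1 \<gamma>2 \<gamma>3 \<gamma>4 \<kappa> \<rho> \<Upsilon> \<nu>1 \<nu>2 \<omega> :: complex
  assumes "A < B" and "C < D"
    and "Re \<gamma>1 > 0" and "Re \<gamma>2 > 0" and "Re \<gamma>3 > 0" and "Re \<gamma>4 > 0"
    and "Re \<kappa> > 0" and "Re \<rho> > 0" and "Re \<Upsilon> > 0"
    and "\<omega> \<in> cpow_values \<nu>2 \<Upsilon>"
  shows "\<exists>K::real. 0 \<le> K \<and> (\<forall>\<psi> \<in> L1_space A B C D.
      (AE (X, Y) in lebesgue_on ({A<..<B} \<times> {C<..<D}).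
        (\<lambda>q. HK_kernel \<kappa> \<rho> \<Upsilon> \<nu>1 \<omega> \<gamma>1 \<gamma>2 \<gamma>3 \<gamma>4 (X, Y) q * \<psi> q)
          absolutely_integrable_on ({A<..<X} \<times> {C<..<Y})) \<and>
      HK_op A C \<kappa> \<rho> \<Upsilon> \<nu>1 \<omega> \<gamma>1 \<gamma>2 \<gamma>3 \<gamma>4 \<psi> \<in> L1_space A B C D \<and>
      L1_norm A B C D (HK_op A C \<kappa> \<rho> \<Upsilon> \<nu>1 \<omega> \<gamma>1 \<gamma>2 \<gamma>3 \<gamma>4 \<psi>) \<le> ennreal K * L1_norm A B C D \<psi>)"
proof -
  obtain K where "K \<ge> 0" and K: "\<And>t \<Omega>. t \<in> {A<..<B} \<Longrightarrow> \<Omega> \<in> {C<..<D} \<Longrightarrow>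
      (\<integral>\<^sup>+p. ennreal (norm (HK_kernel \<kappa> \<rho> \<Upsilon> \<nu>1 \<omega> \<gamma>1 \<gamma>2 \<gamma>3 \<gamma>4 p (t, \<Omega>))) *
        indicator ({t<..<B} \<times> {\<Omega><..<D}) p \<partial>lborel) \<le> ennreal K"
    using HK_kernel_nn_integral_bounded[OF assms(5-9)] by blast
  then show ?thesis
    using L1_bounded_triangular_kernel[OF measurable_HK_kernel K]
    unfolding HK_op_def by (intro exI[of _ K] conjI ballI) blast+
qed

end
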